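(* Let $E:\mathbb{R}^n\to\mathbb{R}^n$ and $\Psi:\mathbb{R}^n\times\mathbb{R}^n\to\mathbb{R}^n$ be maps, and consider the problem (P): minimize $h(s)$ subject to $h_j(s)\le 0$, $1\le j\le k$, $s\in\mathbb{R}^n$, where $h,h_1,\dots,h_k:\mathbb{R}^n\to\mathbb{R}$ are either all SSEP w.r.t. $\Psi$ on $\mathbb{R}^n$ or all SQSEP w.r.t. $\Psi$ on $\mathbb{R}^n$. Let $X=\{s\in\mathbb{R}^n: h_j(s)\le 0,\ 1\le j\le k\}$ be the feasible set, and let $X$ be an SEI set w.r.t. $\Psi$. If $h$ is SSSEP w.r.t. $\Psi$ on $X$, then the global optimal solution of (P) is unique (i.e. any two global optimal solutions of (P) coincide).
   Context: Write $Es$ for $E(s)$. A set $S\subseteq\mathbb{R}^n$ is strongly $E$-invex (SEI) w.r.t. $\Psi$ if $\alpha t+Et+\lambda\Psi(\alpha s+Es,\alpha t+Et)\in S$ for all $s,t\in S$, $\alpha\in[0,1]$, $\lambda\in[0,1]$. Let $S$ be an SEI set w.r.t. $\Psi$ and $h$ a real-valued function defined on a set containing $S$. - $h$ is semi strongly $E$-preinvex (SSEP) w.r.t. $\Psi$ on $S$ if $h(\alpha t+Et+\lambda\Psi(\alpha s+Es,\alpha t+Et))\le\lambda h(s)+(1-\lambda)h(t)$ for all $s,t\in S$, $\alpha,\lambda\in[0,1]$. - $h$ is semi quasi strongly $E$-preinvex (SQSEP) w.r.t. $\Psi$ on $S$ if $h(\alpha t+Et+\lambda\Psi(\alpha s+Es,\alpha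 t+Et))\le\max\{h(s),h(t)\}$ for all $s,t\in S$, $\alpha,\lambda\in[0,1]$. - $h$ is strictly semi strongly $E$-preinvex (SSSEP) w.r.t. $\Psi$ on $S$ if $h(\alpha t+Et+\lambda\Psi(\alpha s+Es,\alpha t+Et))<\lambda h(s)+(1-\lambda)h(t)$ for all $s,t\in S$, $\alpha\in[0,1]$, $\lambda\in(0,1)$ with $\alpha s+Es\ne\alpha t+Et$. A global optimal solution of (P) is a point of $X$ at which $h$ attains its minimum over $X$. *)

theory Defs
  imports "HOL-Analysis.Analysis"
begin

text \<open>SEI: strongly E-invex; SSEP: semi strongly E-preinvex; SQSEP: semi quasi strongly
  E-preinvex; SSSEP: strictly semi strongly E-preinvex.\<close>

definition SEI ::
  "('a::real_vector \<Rightarrow> 'a) \<Rightarrow> ('a \<times> 'a \<Rightarrow> 'a) \<Rightarrow> 'a set \<Rightarrow> bool" where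
  "SEI E \<Psi> S \<longleftrightarrow>
    (\<forall>s\<in>S. \<forall>t\<in>S. \<forall>\<alpha>\<in>{0..1::real}. \<forall>\<mu>\<in>{0..1::real}.
      \<alpha> *\<^sub>R t + E t + \<mu> *\<^sub>R \<Psi> (\<alpha> *\<^sub>R s + E s, \<alpha> *\<^sub>R t + E t) \<in> S)"

text \<open>The function classes below are meant for sets S with \<open>SEI E \<Psi> S\<close>. That standing
  assumption is not a conjunct of the definitions: it holds trivially for the whole space
  and has to be stated separately for any other set.\<close>

definition SSEP ::
  "('a::real_vector \<Rightarrow> 'a) \<Rightarrow> ('a \<times> 'a \<Rightarrow> 'a) \<Rightarrow> 'a set \<Rightarrow> ('a \<Rightarrow> real) \<Rightarrow> bool" where
  "SSEP E \<Psi> S h \<longleftrightarrow>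
    (\<forall>s\<in>S. \<forall>t\<in>S. \<forall>\<alpha>\<in>{0..1::real}. \<forall>\<mu>\<in>{0..1::real}.
      h (\<alpha> *\<^sub>R t + E t + \<mu> *\<^sub>R \<Psi> (\<alpha> *\<^sub>R s + E s, \<alpha> *\<^sub>R t + E t))
        \<le> \<mu> * h s + (1 - \<mu>) * h t)"

definition SQSEP ::
  "('a::real_vector \<Rightarrow> 'a) \<Rightarrow> ('a \<times> 'a \<Rightarrow> 'a) \<Rightarrow> 'a set \<Rightarrow> ('a \<Rightarrow> real) \<Rightarrow> bool" where
  "SQSEP E \<Psi> S h \<longleftrightarrow>
    (\<forall>s\<in>S. \<forall>t\<in>S. \<forall>\<alpha>\<in>{0..1::real}. \<forall>\<mu>\<in>{0..1::real}.
      h (\<alpha> *\<^sub>R t + E t + \<mu> *\<^sub>R \<Psi> (\<alpha> *\<^sub>R s + E s, \<alpha> *\<^sub>R t + E t))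
        \<le> max (h s) (h t))"

definition SSSEP ::
  "('a::real_vector \<Rightarrow> 'a) \<Rightarrow> ('a \<times> 'a \<Rightarrow> 'a) \<Rightarrow> 'a set \<Rightarrow> ('a \<Rightarrow> real) \<Rightarrow> bool" where
  "SSSEP E \<Psi> S h \<longleftrightarrow>
    (\<forall>s\<in>S. \<forall>t\<in>S. \<forall>\<alpha>\<in>{0..1::real}. \<forall>\<mu>\<in>{0<..<1::real}.
      \<alpha> *\<^sub>R s + E s \<noteq> \<alpha> *\<^sub>R t + E t \<longrightarrow>
      h (\<alpha> *\<^sub>R t + E t + \<mu> *\<^sub>R \<Psi> (\<alpha> *\<^sub>R s + E s, \<alpha> *\<^sub>R t + E t))
        < \<mu> * h s + (1 - \<mu>) * h t)"

lemma SEI_UNIV: "SEI E \<Psi> UNIV"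
  by (simp add: SEI_def)

end

theory Submission
  imports Defs
begin

text \<open>For distinct s and t the points \<open>\<alpha> s + E s\<close> and \<open>\<alpha> t + E t\<close> cannot coincide both at
  \<open>\<alpha> = 0\<close> and at \<open>\<alpha> = 1\<close>. If s and t are minimizers, strictness at such an \<open>\<alpha>\<close>, with
  \<open>\<mu> = 1/2\<close>, gives a feasible point below the minimum.\<close>

lemma SSSEP_is_arg_min_unique:
  fixes h :: "'a::real_vector \<Rightarrow> real"
  assumes "SEI E \<Psi> X" and "SSSEP E \<Psi> X h"
    and s: "is_arg_min h (\<lambda>x. x \<in> X) s" and t: "is_arg_min h (\<lambda>x. x \<in> X) t"
  shows "s = t"
proof (rule ccontr)
  assume "s \<noteq> t"
  \<comment> \<open>If \<open>E s = E t\<close>, the two points at \<alpha> = 1 differ by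
    \<open>s - t\<close>, which is nonzero; otherwise at \<alpha> = 0 they are \<open>E s\<close>
    and \<open>E t\<close> themselves.\<close>
  then obtain \<alpha> :: real where \<alpha>: "\<alpha> \<in> {0..1}" and ne: "\<alpha> *\<^sub>R s + E s \<noteq> \<alpha> *\<^sub>R t + E t"
  proof (cases "E s = E t")
    case True
    with \<open>s \<noteq> t\<close> show ?thesis using that[of 1] by simp
  next
    case False
    then show ?thesis using that[of 0] by simp
  qed
  \<comment> \<open>Any weight strictly between 0 and 1 would do in place of \<open>1/2\<close>: SEI
    puts \<open>z\<close> in \<open>X\<close>, and SSSEP is strict only away from the
    endpoints.\<close>
  define z where "z = \<alpha> *\<^sub>R t + E t + (1/2) *\<^sub>R \<Psi> (\<alpha> *\<^sub>R s + E s, \<alpha> *\<^sub>R t + E t)"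
  have X: "s \<in> X" "t \<in> X" using s t by (auto simp: is_arg_min_def)
  have "z \<in> X"
    unfolding z_def by (rule assms(1)[unfolded SEI_def, rule_format]) (use X \<alpha> in auto)
  then have min: "h s \<le> h z" "h t \<le> h z"
    using s t by (auto simp: is_arg_min_linorder)
  have "h z < (1/2) * h s + (1 - 1/2) * h t"
    unfolding z_def by (rule assms(2)[unfolded SSSEP_def, rule_format]) (use X \<alpha> ne in auto)
  \<comment> \<open>The bound is a mean of two values that are at most \<open>h z\<close>, so
    \<open>h z < h z\<close>.\<close>
  with min show False by simp
qed

theorem theorem22:
  fixes E :: "real ^ 'n \<Rightarrow> real ^ 'n"
    and \<Psi> :: "(real ^ 'n) \<times> (real ^ 'n) \<Rightarrow> real ^ 'n"
    and h :: "real ^ 'n \<Rightarrow> real"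
    and hc :: "nat \<Rightarrow> real ^ 'n \<Rightarrow> real"
    and k :: nat
    and X :: "(real ^ 'n) set"
  assumes "(SSEP E \<Psi> UNIV h \<and> (\<forall>j\<in>{1..k}. SSEP E \<Psi> UNIV (hc j))) \<or>
           (SQSEP E \<Psi> UNIV h \<and> (\<forall>j\<in>{1..k}. SQSEP E \<Psi> UNIV (hc j)))"
    and "X = {s. \<forall>j\<in>{1..k}. hc j s \<le> 0}"
    and "SEI E \<Psi> X"
    and "SSSEP E \<Psi> X h"
  shows "\<forall>s t. is_arg_min h (\<lambda>x. x \<in> X) s \<and> is_arg_min h (\<lambda>x. x \<in> X) t \<longrightarrow> s = t"
  using SSSEP_is_arg_min_unique[OF assms(3,4)] by blast

end
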